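(* Let $m, n, k$ be integers with $k \geq 1$ and $m \geq n > 2k$. Then the $k$-th bandwidth reduction number of the rectangular grid $G_{m,n}$ satisfies \[ br_k(G_{m,n}) \leq m-n+2k. \] Equivalently, since the bandwidth of $G_{m,n}$ is $n$ here: there is a vertex numbering $\nu$ of $G_{m,n}$ for which at most $m-n+2k$ edges $e$ have $f_\nu(e) > n-k$.
   Context: All graphs are finite, simple and undirected. A vertex numbering of a graph $G=(V,E)$ is a bijection $\nu: V \to \{1,2,\dots,|V|\}$. For an edge $e=uv$, its length induced by $\nu$ is $f_\nu(e)=|\nu(u)-\nu(v)|$. The bandwidth of $\nu$ is the largest induced edge length (0 if $E=\emptyset$), and the bandwidth $b(G)$ of $G$ is the minimum bandwidth over all vertex numberings of $G$. For $k=1,\dots,b(G)$, the $k$-th bandwidth reduction number $br_k(G)$ is the minimal number of edges that must be deleted from $G$ to obtain a (spanning) subgraph of bandwidth at most $b(G)-k$; equivalently $br_k(G)=\min_\nu |\{e\in E : f_\nu(e) > b(G)-k\}|$. For $m \geq n \geq 1$, the rectangular grid $G_{m,n}$ has vertex set $\{1,\dots,m\}\times\{1,\dots,n\}$, with two vertices adjacent iff their Euclidean distance is $1$. It is known that the bandwidth of $G_{m,n}$ is $n$ when $m \geq 2$. *)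

theory Defs
  imports "HOL-Analysis.Analysis"
begin

definition simple_graph :: "'a set \<Rightarrow> 'a set set \<Rightarrow> bool" where
  "simple_graph V E \<longleftrightarrow> finite V \<and> (\<forall>e\<in>E. e \<subseteq> V \<and> card e = 2)"

definition vertex_numbering :: "'a set \<Rightarrow> ('a \<Rightarrow> nat) \<Rightarrow> bool" where
  "vertex_numbering V \<nu> \<longleftrightarrow> bij_betw \<nu> V {1..card V}"

(* Meaningful for two-element sets e; see edge_length_doubleton below. *)
definition edge_length :: "('a \<Rightarrow> nat) \<Rightarrow> 'a set \<Rightarrow> nat" where
  "edge_length \<nu> e = Max (\<nu> ` e) - Min (\<nu> ` e)"

lemma edge_length_doubleton:
  "edge_length \<nu> {u, v} = nat \<bar>int (\<nu> u) - int (\<nu> v)\<bar>"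
  by (auto simp: edge_length_def max_def min_def)

definition numbering_bandwidth :: "'a set set \<Rightarrow> ('a \<Rightarrow> nat) \<Rightarrow> nat" where
  "numbering_bandwidth E \<nu> = Max (insert 0 (edge_length \<nu> ` E))"

definition bandwidth :: "'a set \<Rightarrow> 'a set set \<Rightarrow> nat" where
  "bandwidth V E = (LEAST b. \<exists>\<nu>. vertex_numbering V \<nu> \<and> numbering_bandwidth E \<nu> = b)"

(* Meaningful for finite E and k \<le> bandwidth V E. The bound "at most b(G) - k" is written
   additively to avoid truncated subtraction. *)
definition bandwidth_reduction_number :: "nat \<Rightarrow> 'a set \<Rightarrow> 'a set set \<Rightarrow> nat" where
  "bandwidth_reduction_number k V E =
     (LEAST c. \<exists>F. F \<subseteq> E \<and> card F = c \<and> bandwidth V (E - F) + k \<le> bandwidth V E)"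

definition grid_vertices :: "nat \<Rightarrow> nat \<Rightarrow> (nat \<times> nat) set" where
  "grid_vertices m n = {1..m} \<times> {1..n}"

(* dist on real \<times> real is the Euclidean distance. *)
definition grid_edges :: "nat \<Rightarrow> nat \<Rightarrow> (nat \<times> nat) set set" where
  "grid_edges m n =
     {{(i, j), (i', j')} | i j i' j'.
        (i, j) \<in> grid_vertices m n \<and> (i', j') \<in> grid_vertices m n \<and>
        dist (real i, real j) (real i', real j') = 1}"

lemma simple_graph_grid: "simple_graph (grid_vertices m n) (grid_edges m n)"
  by (auto simp: simple_graph_def grid_vertices_def grid_edges_def card_insert_if)

end

theory Submission imports Defs begin

text \<open>
  Upper bound: with \<open>c = m - n + 2 * k\<close>, cut the \<open>c\<close> leftmost edges joining row \<open>n - k\<close> to row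
  \<open>n - k + 1\<close>. The strip of \<open>k\<close> rows beyond this slit is then attached only at the end of the slit.
  Sweep the rest by the antidiagonals \<open>x + y = const\<close>; once the sweep has passed the end of the slit,
  interleave it with a sweep of the strip running backwards. From then on the top right corner leaves
  only \<open>n - 2 * k\<close> main vertices on an antidiagonal, which makes room for the \<open>k\<close> strip vertices.

  Lower bound \<open>n\<close> on the bandwidth of the grid: consider the vertices numbered before the first moment
  at which a full row or column is completed. Every line crossing the completed one contains an
  unnumbered vertex adjacent to a numbered one, and there are at least \<open>n\<close> of these lines.
\<close>

section \<open>Numberings obtained by ranking integer keys\<close>

definition rank_numbering :: "'a set \<Rightarrow> ('a \<Rightarrow> int) \<Rightarrow> 'a \<Rightarrow> nat" where
  "rank_numbering V key v = card {u \<in> V. key u \<le> key v}"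

lemma rank_numbering_less:
  assumes "finite V" "v \<in> V" "key u < key v"
  shows "rank_numbering V key u < rank_numbering V key v"
  unfolding rank_numbering_def
proof (rule psubset_card_mono)
  show "finite {u \<in> V. key u \<le> key v}" using assms by simp
  have "v \<in> {z \<in> V. key z \<le> key v}" "v \<notin> {z \<in> V. key z \<le> key u}"
    using assms by auto
  moreover have "{z \<in> V. key z \<le> key u} \<subseteq> {z \<in> V. key z \<le> key v}"
    using assms by auto
  ultimately show "{z \<in> V. key z \<le> key u} \<subset> {z \<in> V. key z \<le> key v}" by blast
qed

lemma vertex_numbering_rank:
  assumes "finite V" "inj_on key V"
  shows "vertex_numbering V (rank_numbering V key)"
proof -
  let ?r = "rank_numbering V key"
  have inj: "inj_on ?r V"
  proof (rule inj_onI)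
    fix u v assume uv: "u \<in> V" "v \<in> V" "?r u = ?r v"
    then have "key u = key v"
      using rank_numbering_less[of V v key u] rank_numbering_less[of V u key v] assms(1)
      by (metis less_irrefl linorder_neqE)
    then show "u = v" using assms(2) uv by (simp add: inj_on_eq_iff)
  qed
  have "?r ` V \<subseteq> {1..card V}"
  proof
    fix y assume "y \<in> ?r ` V"
    then obtain v where v: "v \<in> V" "y = ?r v" by blast
    have "card {v} \<le> ?r v" unfolding rank_numbering_def
      by (rule card_mono) (use assms v in auto)
    moreover have "?r v \<le> card V" unfolding rank_numbering_def
      by (rule card_mono) (use assms in auto)
    ultimately show "y \<in> {1..card V}" using v by simp
  qed
  then have "?r ` V = {1..card V}"
    using inj by (intro card_subset_eq) (auto simp: card_image)
  then show ?thesis using inj by (simp add: vertex_numbering_def bij_betw_def)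
qed

text \<open>A window of \<open>W\<close> consecutive keys contains at most one vertex of each of the \<open>b\<close> colours.\<close>

lemma rank_numbering_diff_le:
  fixes key :: "'a \<Rightarrow> int"
  assumes "finite V"
    and colour: "\<And>v. v \<in> V \<Longrightarrow> colour v < b"
    and sep: "\<And>u v. u \<in> V \<Longrightarrow> v \<in> V \<Longrightarrow> u \<noteq> v \<Longrightarrow> colour u = colour v \<Longrightarrow> W \<le> \<bar>key u - key v\<bar>"
    and close: "\<bar>key u - key v\<bar> \<le> W"
  shows "nat \<bar>int (rank_numbering V key u) - int (rank_numbering V key v)\<bar> \<le> b"
proof -
  have le: "rank_numbering V key y \<le> rank_numbering V key x + b
      \<and> rank_numbering V key x \<le> rank_numbering V key y"
    if xy: "key x \<le> key y" "key y \<le> key x + W" for x y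
  proof -
    \<comment> \<open>The ranks of \<open>x\<close> and \<open>y\<close> differ by
      \<open>card ?Z\<close>. The window is open at \<open>key x\<close>, so two keys in it differ
      by less than \<open>W\<close>.\<close>
    let ?Z = "{z \<in> V. key x < key z \<and> key z \<le> key y}"
    have "inj_on colour ?Z"
    proof (rule inj_onI, rule ccontr)
      fix p q assume pq: "p \<in> ?Z" "q \<in> ?Z" "colour p = colour q" "p \<noteq> q"
      then have "W \<le> \<bar>key p - key q\<bar>" using sep by blast
      then show False using pq xy by auto
    qed
    moreover have "colour ` ?Z \<subseteq> {..<b}" using colour by auto
    ultimately have "card ?Z \<le> card {..<b}" by (intro card_inj_on_le) auto
    moreover have "card {z \<in> V. key z \<le> key y} = card ({z \<in> V. key z \<le> key x} \<union> ?Z)"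
      using xy by (intro arg_cong[where f = card]) auto
    moreover have "\<dots> = card {z \<in> V. key z \<le> key x} + card ?Z"
      using assms(1) by (intro card_Un_disjoint) auto
    ultimately show ?thesis by (simp add: rank_numbering_def)
  qed
  show ?thesis
    using le[of u v] le[of v u] close by linarith
qed

section \<open>Bandwidth and its reduction number\<close>

lemma numbering_bandwidth_le_iff:
  "finite E \<Longrightarrow> numbering_bandwidth E \<nu> \<le> b \<longleftrightarrow> (\<forall>e\<in>E. edge_length \<nu> e \<le> b)"
  by (simp add: numbering_bandwidth_def)

lemma bandwidth_le:
  "vertex_numbering V \<nu> \<Longrightarrow> bandwidth V E \<le> numbering_bandwidth E \<nu>"
  unfolding bandwidth_def by (rule Least_le) blast

text \<open>The numbering \<open>\<mu>\<close> only ensures that the \<open>LEAST\<close> ranges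
  over a nonempty set.\<close>

lemma bandwidth_attained:
  assumes "vertex_numbering V \<mu>"
  obtains \<nu> where "vertex_numbering V \<nu>" "numbering_bandwidth E \<nu> = bandwidth V E"
proof -
  have "\<exists>\<nu>. vertex_numbering V \<nu> \<and> numbering_bandwidth E \<nu> = bandwidth V E"
    unfolding bandwidth_def by (rule LeastI_ex) (use assms in blast)
  then show ?thesis using that by blast
qed

lemma bandwidth_reduction_number_le:
  "F \<subseteq> E \<Longrightarrow> bandwidth V (E - F) + k \<le> bandwidth V E
    \<Longrightarrow> bandwidth_reduction_number k V E \<le> card F"
  unfolding bandwidth_reduction_number_def by (rule Least_le) blast

section \<open>Edges of the grid\<close>

lemma finite_grid_vertices: "finite (grid_vertices m n)"
  by (simp add: grid_vertices_def)

lemma finite_grid_edges: "finite (grid_edges m n)"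
proof (rule finite_subset)
  show "grid_edges m n \<subseteq> Pow (grid_vertices m n)" by (auto simp: grid_edges_def)
qed (simp add: finite_grid_vertices)

lemma dist_nat_pair_eq_1_iff:
  "dist (real i, real j) (real i', real j') = 1 \<longleftrightarrow>
    (j = j' \<and> (i' = Suc i \<or> i = Suc i')) \<or> (i = i' \<and> (j' = Suc j \<or> j = Suc j'))"
proof -
  have "dist (real i, real j) (real i', real j') = 1 \<longleftrightarrow>
      (real i - real i')\<^sup>2 + (real j - real j')\<^sup>2 = 1"
    by (simp add: dist_Pair_Pair dist_real_def)
  \<comment> \<open>Over the integers, two squares with sum 1 leave only -1, 0 and 1 for each
    difference.\<close>
  also have "\<dots> \<longleftrightarrow> real_of_int ((int i - int i')\<^sup>2 + (int j - int j')\<^sup>2) = real_of_int 1"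
    by simp
  also have "\<dots> \<longleftrightarrow> (int i - int i')\<^sup>2 + (int j - int j')\<^sup>2 = 1"
    by (rule of_int_eq_iff)
  also have "\<dots> \<longleftrightarrow> (j = j' \<and> (i' = Suc i \<or> i = Suc i')) \<or> (i = i' \<and> (j' = Suc j \<or> j = Suc j'))"
    (is "?a\<^sup>2 + ?b\<^sup>2 = 1 \<longleftrightarrow> ?R")
  proof
    assume eq: "?a\<^sup>2 + ?b\<^sup>2 = 1"
    have "?a\<^sup>2 \<le> 1" "?b\<^sup>2 \<le> 1"
      using eq zero_le_power2[of ?a] zero_le_power2[of ?b] by linarith+
    then have "\<bar>?a\<bar> \<le> 1" "\<bar>?b\<bar> \<le> 1" by (simp_all add: abs_square_le_1)
    then have "?a \<in> {-1, 0, 1}" "?b \<in> {-1, 0, 1}" by auto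
    then show ?R using eq by auto
  qed auto
  finally show ?thesis .
qed

lemma grid_edges_cases:
  assumes "e \<in> grid_edges m n"
  obtains (horizontal) x y where "e = {(x, y), (Suc x, y)}" "1 \<le> x" "x < m" "1 \<le> y" "y \<le> n"
  | (vertical) x y where "e = {(x, y), (x, Suc y)}" "1 \<le> x" "x \<le> m" "1 \<le> y" "y < n"
  using assms
  unfolding grid_edges_def dist_nat_pair_eq_1_iff grid_vertices_def
  by (auto simp: insert_commute)

lemma grid_edge_horizontal:
  "1 \<le> x \<Longrightarrow> x < m \<Longrightarrow> 1 \<le> y \<Longrightarrow> y \<le> n \<Longrightarrow> {(x, y), (Suc x, y)} \<in> grid_edges m n"
  unfolding grid_edges_def dist_nat_pair_eq_1_iff grid_vertices_def
  by (intro CollectI exI[of _ x] exI[of _ y] exI[of _ "Suc x"]) auto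

lemma grid_edge_vertical:
  "1 \<le> x \<Longrightarrow> x \<le> m \<Longrightarrow> 1 \<le> y \<Longrightarrow> y < n \<Longrightarrow> {(x, y), (x, Suc y)} \<in> grid_edges m n"
  unfolding grid_edges_def dist_nat_pair_eq_1_iff grid_vertices_def
  by (intro CollectI exI[of _ x] exI[of _ y] exI[of _ "Suc y"]) auto

section \<open>Lower bound on the bandwidth of the grid\<close>

lemma change_between_neighbours:
  fixes a b p :: nat
  assumes "a \<in> {1..p}" "b \<in> {1..p}" "P a" "\<not> P b"
  obtains i where "i \<in> {1..<p}" "P i \<noteq> P (Suc i)"
proof -
  have mono: "P x = P 1" if "\<And>i. i \<in> {1..<p} \<Longrightarrow> P i = P (Suc i)" "1 \<le> x" "x \<le> p" for x
    using that(2,3) by (induction x rule: dec_induct) (use that(1) in auto)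
  show thesis
    using that mono[of a] mono[of b] assms by auto
qed

text \<open>Just before the first line is completed, each of the \<open>q\<close> lines crossing it contains an unused
  vertex with a used neighbour; these \<open>q\<close> vertices have distinct numbers in \<open>{t..<t + n - 1}\<close>.\<close>

lemma first_line_contradiction:
  fixes f :: "nat \<Rightarrow> nat \<Rightarrow> nat"
  assumes inj: "\<And>i j i' j'. i \<in> {1..p} \<Longrightarrow> j \<in> {1..q} \<Longrightarrow> i' \<in> {1..p} \<Longrightarrow> j' \<in> {1..q}
      \<Longrightarrow> f i j = f i' j' \<Longrightarrow> j = j'"
    and along: "\<And>i j. i \<in> {1..<p} \<Longrightarrow> j \<in> {1..q} \<Longrightarrow> f i j < f (Suc i) j + n \<and> f (Suc i) j < f i j + n"
    and across: "\<And>i j. i \<in> {1..p} \<Longrightarrow> j \<in> {1..<q} \<Longrightarrow> f i j < f i (Suc j) + n \<and> f i (Suc j) < f i j + n"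
    and q: "n \<le> q" "2 \<le> q"
    and line: "i0 \<in> {1..p}" "j0 \<in> {1..q}" "f i0 j0 = t"
      "\<And>j. j \<in> {1..q} \<Longrightarrow> j \<noteq> j0 \<Longrightarrow> f i0 j < t"
    and nofull: "\<And>j. j \<in> {1..q} \<Longrightarrow> \<exists>i\<in>{1..p}. t \<le> f i j"
  shows False
proof -
  have "\<exists>i\<in>{1..p}. t \<le> f i j \<and> f i j < t + n - 1" if j: "j \<in> {1..q}" for j
  proof (cases "j = j0")
    case True
    \<comment> \<open>This says \<open>n \<ge> 2\<close>: since \<open>q \<ge> 2\<close>, the vertex
      numbered \<open>t\<close> has a neighbour on its line, whose number is smaller but by less
      than \<open>n\<close>.\<close>
    have "t < t + n - 1"
    proof (cases "j0 < q")
      case True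
      then show ?thesis using across[of i0 j0] line(4)[of "Suc j0"] line(1-3) by simp
    next
      case False
      then have "j0 - 1 \<in> {1..<q}" "Suc (j0 - 1) = j0" using q line by auto
      then show ?thesis using across[of i0 "j0 - 1"] line(4)[of "j0 - 1"] line(1-3) by simp
    qed
    then show ?thesis using True line by auto
  next
    case False
    then have "f i0 j < t" using line j by auto
    moreover obtain i1 where i1: "i1 \<in> {1..p}" "t \<le> f i1 j" using nofull j by blast
    ultimately obtain i where i: "i \<in> {1..<p}" "(f i j < t) \<noteq> (f (Suc i) j < t)"
      using change_between_neighbours[of i0 p i1 "\<lambda>i. f i j < t"] line(1) by (metis linorder_not_le)
    have d: "f i j < f (Suc i) j + n" "f (Suc i) j < f i j + n" using along i j by auto
    show ?thesis
    proof (cases "f i j < t")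
      case True
      then have "t \<le> f (Suc i) j \<and> f (Suc i) j < t + n - 1" using i d by auto
      then show ?thesis using i by (intro bexI[of _ "Suc i"]) auto
    next
      case False
      then have "t \<le> f i j \<and> f i j < t + n - 1" using i d by auto
      then show ?thesis using i by (intro bexI[of _ i]) auto
    qed
  qed
  then obtain g where g: "\<And>j. j \<in> {1..q} \<Longrightarrow> g j \<in> {1..p} \<and> t \<le> f (g j) j \<and> f (g j) j < t + n - 1"
    by metis
  have "inj_on (\<lambda>j. f (g j) j) {1..q}"
    using inj g by (intro inj_onI) blast
  moreover have "(\<lambda>j. f (g j) j) ` {1..q} \<subseteq> {t..<t + n - 1}" using g by auto
  ultimately have "card {1..q} \<le> card {t..<t + n - 1}"
    by (intro card_inj_on_le) auto
  then show False using q by simp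
qed

lemma numbering_bandwidth_grid_ge:
  assumes \<nu>: "vertex_numbering (grid_vertices m n) \<nu>" and n: "2 \<le> n" "n \<le> m"
  shows "n \<le> numbering_bandwidth (grid_edges m n) \<nu>"
proof (rule ccontr)
  assume "\<not> ?thesis"
  then have short: "edge_length \<nu> e < n" if "e \<in> grid_edges m n" for e
    using numbering_bandwidth_le_iff[OF finite_grid_edges, of m n \<nu> "n - 1"] that n by fastforce
  define f where "f x y = \<nu> (x, y)" for x y
  have horizontal: "f x y < f (Suc x) y + n \<and> f (Suc x) y < f x y + n"
    if "x \<in> {1..<m}" "y \<in> {1..n}" for x y
    using short[OF grid_edge_horizontal[of x m y n]] that
    by (auto simp: edge_length_doubleton f_def)
  have vertical: "f x y < f x (Suc y) + n \<and> f x (Suc y) < f x y + n"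
    if "x \<in> {1..m}" "y \<in> {1..<n}" for x y
    using short[OF grid_edge_vertical[of x m y n]] that
    by (auto simp: edge_length_doubleton f_def)
  have inj: "x = x' \<and> y = y'"
    if "x \<in> {1..m}" "y \<in> {1..n}" "x' \<in> {1..m}" "y' \<in> {1..n}" "f x y = f x' y'" for x y x' y'
    using \<nu> that unfolding vertex_numbering_def bij_betw_def f_def grid_vertices_def
    by (auto dest!: inj_onD)
  \<comment> \<open>The bound is strict, so \<open>full 0\<close> fails. Just before
    \<open>full\<close> first holds, the vertex numbered \<open>t\<close> is the one that completes
    a line.\<close>
  define full where "full t \<longleftrightarrow> (\<exists>x\<in>{1..m}. \<forall>y\<in>{1..n}. f x y < t) \<or> (\<exists>y\<in>{1..n}. \<forall>x\<in>{1..m}. f x y < t)" for t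
  have "full (Suc (Max (f 1 ` {1..n})))"
    unfolding full_def using n by (intro disjI1 bexI[of _ 1]) (auto simp: less_Suc_eq_le)
  moreover have "\<not> full 0" unfolding full_def using n by fastforce
  ultimately obtain t where t: "\<not> full t" "full (Suc t)"
    using ex_least_nat_less[of full] by blast
  have col: "\<exists>y\<in>{1..n}. t \<le> f x y" if "x \<in> {1..m}" for x
    using t(1) that unfolding full_def by (auto simp: not_less)
  have row: "\<exists>x\<in>{1..m}. t \<le> f x y" if "y \<in> {1..n}" for y
    using t(1) that unfolding full_def by (auto simp: not_less)
  from t(2) show False unfolding full_def
  proof
    assume "\<exists>x\<in>{1..m}. \<forall>y\<in>{1..n}. f x y < Suc t"
    then obtain x where x: "x \<in> {1..m}" "\<And>y. y \<in> {1..n} \<Longrightarrow> f x y \<le> t" by (auto simp: less_Suc_eq_le)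
    obtain y where y: "y \<in> {1..n}" "f x y = t" using col[OF x(1)] x(2) by (meson le_antisym)
    have "f x y' < t" if "y' \<in> {1..n}" "y' \<noteq> y" for y'
      using x(2)[OF that(1)] inj[OF x(1) that(1) x(1) y(1)] y(2) that(2) by fastforce
    then show False
      using inj by (intro first_line_contradiction[of m n f n x y t, OF _ horizontal vertical order_refl n(1)
            x(1) y _ row]) blast+
  next
    assume "\<exists>y\<in>{1..n}. \<forall>x\<in>{1..m}. f x y < Suc t"
    then obtain y where y: "y \<in> {1..n}" "\<And>x. x \<in> {1..m} \<Longrightarrow> f x y \<le> t" by (auto simp: less_Suc_eq_le)
    obtain x where x: "x \<in> {1..m}" "f x y = t" using row[OF y(1)] y(2) by (meson le_antisym)
    have "f x' y < t" if "x' \<in> {1..m}" "x' \<noteq> x" for x'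
      using y(2)[OF that(1)] inj[OF that(1) y(1) x(1) y(1)] x(2) that(2) by fastforce
    \<comment> \<open>Rows and columns exchange roles: the completed row is crossed by
      \<open>m \<ge> n\<close> columns.\<close>
    then show False
      using inj by (intro first_line_contradiction[of n m "\<lambda>y x. f x y" n y x t,
            OF _ vertical horizontal n(2) order_trans[OF n] y(1) x _ col]) blast+
  qed
qed

section \<open>Slit, strip and sweep order\<close>

context
  fixes m n k :: nat
  assumes k: "1 \<le> k" and mn: "n \<le> m" and nk: "2 * k < n"
begin

definition slit_length :: nat where
  "slit_length = m - n + 2 * k"

definition in_strip :: "nat \<times> nat \<Rightarrow> bool" where
  "in_strip v \<longleftrightarrow> fst v \<le> slit_length \<and> n - k < snd v"

text \<open>The strip gets the level of its mirror image in the end of the slit, plus one; the extra delay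
  is needed, as without it some edges have length \<open>n - k + 1\<close>.\<close>

definition level :: "nat \<times> nat \<Rightarrow> int" where
  "level v = (if in_strip v then 2 * int slit_length + 2 - int (fst v) else int (fst v)) + int (snd v)"

text \<open>Strip offsets lie below \<open>n\<close>, main ones in \<open>{n..<2 * n}\<close>. Rows
  descend within a level so that a vertical edge, which gains one level, does not exceed the window
  width \<open>2 * int n\<close>.\<close>

definition offset :: "nat \<times> nat \<Rightarrow> int" where
  "offset v = (if in_strip v then 0 else int n) + (int n - int (snd v))"

definition sweep_key :: "nat \<times> nat \<Rightarrow> int" where
  "sweep_key v = level v * (2 * int n) + offset v"

text \<open>A main and a strip vertex with the same \<open>chain_row\<close> are at least two levels apart, since the strip
  reaches row \<open>y + (n - 2 * k)\<close> only after the main sweep has left row \<open>y\<close>. Rows that are \<open>n - k\<close> apart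
  likewise do not meet in the window of two successive levels, whence the reduction modulo \<open>n - k\<close>.\<close>

definition chain_row :: "nat \<times> nat \<Rightarrow> nat" where
  "chain_row v = (if in_strip v then snd v - (n - 2 * k) else snd v)"

definition chain :: "nat \<times> nat \<Rightarrow> nat" where
  "chain v = chain_row v mod (n - k)"

lemma grid_coordinates:
  assumes "v \<in> grid_vertices m n"
  shows "1 \<le> fst v" "fst v \<le> m" "1 \<le> snd v" "snd v \<le> n"
  using assms by (auto simp: grid_vertices_def)

text \<open>Level and offset are quotient and remainder modulo \<open>2 * int n\<close>. The offset
  tells strip from main and gives the row; the level then gives the column.\<close>

lemma inj_on_sweep_key: "inj_on sweep_key (grid_vertices m n)"
proof (rule inj_onI)
  fix u v assume uv: "u \<in> grid_vertices m n" "v \<in> grid_vertices m n" "sweep_key u = sweep_key v"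
  have range: "0 \<le> offset z \<and> offset z < 2 * int n" if "z \<in> grid_vertices m n" for z
    using grid_coordinates[OF that] nk by (auto simp: offset_def)
  have "level z = sweep_key z div (2 * int n)" "offset z = sweep_key z mod (2 * int n)"
    if "z \<in> grid_vertices m n" for z
    using range[OF that] nk by (simp_all add: sweep_key_def div_pos_pos_trivial)
  then have eq: "level u = level v" "offset u = offset v" using uv by simp_all
  then have "in_strip u = in_strip v"
    using grid_coordinates[OF uv(1)] grid_coordinates[OF uv(2)]
    by (auto simp: offset_def split: if_splits)
  with eq show "u = v" by (auto simp: offset_def level_def prod_eq_iff split: if_splits)
qed

section \<open>Separation of vertices in the same chain\<close>

lemma sweep_key_diff:
  assumes "level u + d \<le> level v"
  shows "d * (2 * int n) + offset v - offset u \<le> sweep_key v - sweep_key u"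
proof -
  have "(level u + d) * (2 * int n) \<le> level v * (2 * int n)"
    using assms by (intro mult_right_mono) auto
  then show ?thesis by (simp add: sweep_key_def distrib_right)
qed

text \<open>Chain rows lie in \<open>{1..n}\<close> and \<open>n < 2 * (n - k)\<close>, so their
  difference is 0 or 1 times \<open>n - k\<close>.\<close>

lemma same_chain_rows:
  assumes "u \<in> grid_vertices m n" "v \<in> grid_vertices m n" "chain u = chain v"
  shows "chain_row u = chain_row v \<or> chain_row v = chain_row u + (n - k) \<or> chain_row u = chain_row v + (n - k)"
proof -
  have *: "chain_row y = chain_row x \<or> chain_row y = chain_row x + (n - k)"
    if xy: "x \<in> grid_vertices m n" "y \<in> grid_vertices m n" "chain x = chain y" "chain_row x \<le> chain_row y" for x y
  proof -
    have "(n - k) dvd (chain_row y - chain_row x)"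
      using xy by (metis chain_def mod_eq_dvd_iff_nat)
    then obtain q where q: "chain_row y - chain_row x = (n - k) * q" by blast
    have "1 \<le> chain_row x" "chain_row y \<le> n"
      using grid_coordinates[OF xy(1)] grid_coordinates[OF xy(2)] nk k
      by (auto simp: chain_row_def in_strip_def)
    then have "(n - k) * q < (n - k) * 2" using q nk by (simp add: diff_mult_distrib)
    then have "q < 2" by simp
    then have "q = 0 \<or> q = 1" by auto
    then show ?thesis using q xy(4) by auto
  qed
  show ?thesis
    using *[of u v] *[of v u] assms by (metis nat_le_linear)
qed

lemma main_strip_separated:
  assumes "u \<in> grid_vertices m n" "v \<in> grid_vertices m n" "chain u = chain v"
    and "\<not> in_strip u" "in_strip v"
  shows "2 * int n \<le> sweep_key v - sweep_key u"
proof -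
  have b: "snd v - (n - 2 * k) = snd u \<or> snd v - (n - 2 * k) = snd u + (n - k)
      \<or> snd u = snd v - (n - 2 * k) + (n - k)"
    using same_chain_rows[OF assms(1-3)] assms(4,5) by (auto simp: chain_row_def)
  note u = grid_coordinates[OF assms(1)] and v = grid_coordinates[OF assms(2)]
  have v': "fst v \<le> slit_length" "n - k < snd v" using assms(5) by (auto simp: in_strip_def)
  \<comment> \<open>The strip vertex has level at least \<open>slit_length + 2 + snd v\<close>, and
    \<open>slit_length + (n - 2 * k) = m\<close>; in the first two cases of \<open>b\<close> this is
    at least \<open>m + 2 + snd u\<close>. The third would put \<open>u\<close> above row
    \<open>n\<close>.\<close>
  have "level u + 2 \<le> level v"
    using b u v v' assms(4,5) nk mn by (auto simp: level_def slit_length_def)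
  from sweep_key_diff[OF this] show ?thesis
    using b u v v' assms(4,5) nk by (auto simp: offset_def)
qed

text \<open>The strip has only \<open>k\<close> chain rows, so both vertices are main. Then
  \<open>v\<close> lies above the slit row, hence right of the slit, and the levels differ by at
  least \<open>(slit_length + 1 - m) + (n - k) = k + 1\<close>.\<close>

lemma same_kind_separated:
  assumes "u \<in> grid_vertices m n" "v \<in> grid_vertices m n"
    and "in_strip u = in_strip v" "chain_row v = chain_row u + (n - k)"
  shows "2 * int n \<le> sweep_key v - sweep_key u"
proof -
  note u = grid_coordinates[OF assms(1)] and v = grid_coordinates[OF assms(2)]
  have main: "\<not> in_strip u" "\<not> in_strip v"
    using assms(3,4) u v nk by (auto simp: chain_row_def in_strip_def)
  then have rows: "snd v = snd u + (n - k)" using assms(4) by (simp add: chain_row_def)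
  then have "slit_length < fst v" using main(2) u by (auto simp: in_strip_def)
  then have "level u + 2 \<le> level v"
    using main rows u v k nk mn by (auto simp: level_def slit_length_def)
  from sweep_key_diff[OF this] show ?thesis
    using main rows u v nk by (auto simp: offset_def)
qed

lemma same_row_separated:
  assumes "u \<in> grid_vertices m n" "v \<in> grid_vertices m n" "u \<noteq> v"
    and "in_strip u = in_strip v" "chain_row u = chain_row v"
  shows "2 * int n \<le> \<bar>sweep_key u - sweep_key v\<bar>"
proof -
  have rows: "snd u = snd v"
    using assms nk by (auto simp: chain_row_def in_strip_def split: if_splits)
  then have "offset u = offset v" using assms(4) by (simp add: offset_def)
  moreover have "level u + 1 \<le> level v \<or> level v + 1 \<le> level u"
    using rows assms(3,4) by (auto simp: level_def prod_eq_iff)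
  ultimately show ?thesis using sweep_key_diff[of u 1 v] sweep_key_diff[of v 1 u] by auto
qed

lemma same_chain_separated:
  assumes "u \<in> grid_vertices m n" "v \<in> grid_vertices m n" "u \<noteq> v" "chain u = chain v"
  shows "2 * int n \<le> \<bar>sweep_key u - sweep_key v\<bar>"
proof (cases "in_strip u = in_strip v")
  case True
  then show ?thesis
    using same_chain_rows[OF assms(1,2,4)] same_row_separated[OF assms(1,2,3)]
      same_kind_separated[OF assms(1,2)] same_kind_separated[OF assms(2,1)] by auto
next
  case False
  then show ?thesis
    using main_strip_separated[OF assms(1,2,4)] main_strip_separated[OF assms(2,1) assms(4)[symmetric]]
    by (cases "in_strip u") auto
qed

section \<open>Long edges lie on the slit; upper bound\<close>

definition slit_edges :: "(nat \<times> nat) set set" where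
  "slit_edges = (\<lambda>x. {(x, n - k), (x, Suc (n - k))}) ` {1..slit_length}"

lemma card_slit_edges: "card slit_edges \<le> m - n + 2 * k"
  unfolding slit_edges_def using card_image_le[of "{1..slit_length}"] by (simp add: slit_length_def)

definition sweep_numbering :: "nat \<times> nat \<Rightarrow> nat" where
  "sweep_numbering = rank_numbering (grid_vertices m n) sweep_key"

lemma vertex_numbering_sweep: "vertex_numbering (grid_vertices m n) sweep_numbering"
  unfolding sweep_numbering_def
  by (intro vertex_numbering_rank finite_grid_vertices inj_on_sweep_key)

lemma sweep_edge_length_le:
  assumes "\<bar>sweep_key u - sweep_key v\<bar> \<le> 2 * int n"
  shows "edge_length sweep_numbering {u, v} \<le> n - k"
  unfolding edge_length_doubleton sweep_numbering_def
  by (rule rank_numbering_diff_le[where colour = chain, OF finite_grid_vertices])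
    (use assms same_chain_separated nk in \<open>auto simp: chain_def\<close>)

text \<open>Within the strip or within the main part, keys differ by \<open>2 * int n\<close> along
  horizontal edges and by one less along vertical ones.\<close>

lemma long_edges_subset:
  "{e \<in> grid_edges m n. edge_length sweep_numbering e > n - k} \<subseteq> slit_edges"
proof
  fix e assume "e \<in> {e \<in> grid_edges m n. edge_length sweep_numbering e > n - k}"
  then have e: "e \<in> grid_edges m n" and long: "edge_length sweep_numbering e > n - k" by auto
  from e show "e \<in> slit_edges"
  proof (cases rule: grid_edges_cases)
    case (horizontal x y)
    have "\<bar>sweep_key (x, y) - sweep_key (Suc x, y)\<bar> \<le> 2 * int n"
    proof (cases "in_strip (x, y) = in_strip (Suc x, y)")
      case True
      then show ?thesis by (simp add: sweep_key_def level_def offset_def algebra_simps)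
    next
      case False
      then have "x = slit_length" "in_strip (x, y)" "\<not> in_strip (Suc x, y)"
        by (auto simp: in_strip_def)
      \<comment> \<open>At the slit's end the strip vertex is one level later but its offset is
        smaller by \<open>n\<close>, so the keys differ by \<open>n\<close>.\<close>
      then show ?thesis by (simp add: sweep_key_def level_def offset_def algebra_simps)
    qed
    then show ?thesis using sweep_edge_length_le long horizontal(1) by fastforce
  next
    case (vertical x y)
    show ?thesis
    proof (cases "in_strip (x, y) = in_strip (x, Suc y)")
      case True
      then have "\<bar>sweep_key (x, y) - sweep_key (x, Suc y)\<bar> \<le> 2 * int n"
        using nk by (simp add: sweep_key_def level_def offset_def algebra_simps)
      then show ?thesis using sweep_edge_length_le long vertical(1) by fastforce
    next
      case False
      then have "y = n - k" "x \<le> slit_length" by (auto simp: in_strip_def)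
      then show ?thesis using vertical by (auto simp: slit_edges_def)
    qed
  qed
qed

lemma card_long_edges:
  "card {e \<in> grid_edges m n. edge_length sweep_numbering e > n - k} \<le> m - n + 2 * k"
proof -
  have "finite slit_edges" by (simp add: slit_edges_def)
  then show ?thesis using card_mono[OF _ long_edges_subset] card_slit_edges by linarith
qed

lemma bandwidth_reduction_number_grid_le:
  "bandwidth_reduction_number k (grid_vertices m n) (grid_edges m n) \<le> m - n + 2 * k"
proof -
  let ?V = "grid_vertices m n" and ?E = "grid_edges m n"
  let ?F = "{e \<in> ?E. edge_length sweep_numbering e > n - k}"
  have "bandwidth ?V (?E - ?F) \<le> numbering_bandwidth (?E - ?F) sweep_numbering"
    by (rule bandwidth_le[OF vertex_numbering_sweep])
  also have "\<dots> \<le> n - k"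
    by (subst numbering_bandwidth_le_iff) (auto simp: finite_grid_edges)
  finally have "bandwidth ?V (?E - ?F) + k \<le> n" using nk by simp
  \<comment> \<open>The reduction is measured from the true bandwidth of the grid, which is where
    the lower bound \<open>n\<close> enters.\<close>
  moreover obtain \<nu> where "vertex_numbering ?V \<nu>" "numbering_bandwidth ?E \<nu> = bandwidth ?V ?E"
    using bandwidth_attained[OF vertex_numbering_sweep] .
  then have "n \<le> bandwidth ?V ?E"
    using numbering_bandwidth_grid_ge[of m n \<nu>] k mn nk by simp
  ultimately have "bandwidth_reduction_number k ?V ?E \<le> card ?F"
    by (intro bandwidth_reduction_number_le) auto
  then show ?thesis using card_long_edges by linarith
qed

end

theorem theorem3:
  fixes m n k :: nat
  assumes "k \<ge> 1" and "m \<ge> n" and "n > 2 * k"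
  shows "bandwidth_reduction_number k (grid_vertices m n) (grid_edges m n) \<le> m - n + 2 * k
    \<and> (\<exists>\<nu>. vertex_numbering (grid_vertices m n) \<nu> \<and>
          card {e \<in> grid_edges m n. edge_length \<nu> e > n - k} \<le> m - n + 2 * k)"
  using bandwidth_reduction_number_grid_le[OF assms] vertex_numbering_sweep[OF assms]
    card_long_edges[OF assms] by blast

end
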